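(* Consider the delay differential system \[ \begin{aligned} \dot T(t)&= s-dT(t)+aT(t)\Big(1-\frac{T(t)+I(t)}{T_{\max}}\Big)-\frac{bT(t)V(t)}{1+\alpha V(t)},\\ \dot I(t)&= \frac{bT(t-\tau)V(t-\tau)}{1+\alpha V(t-\tau)}+aI(t)\Big(1-\frac{T(t)+I(t)}{T_{\max}}\Big)-\mu I(t),\\ \dot V(t)&= pI(t)-cV(t), \end{aligned} \] with positive constants $s,d,a,T_{\max},b,\alpha,\mu,p,c$ and $\tau\ge0$. Let \[ T_0=\frac{T_{\max}}{2a}\Big(a-d+\sqrt{(a-d)^2+\tfrac{4as}{T_{\max}}}\Big),\qquad R_0=\frac{1}{\mu}\Big[\frac{bpT_0}{c}+a\Big(1-\frac{T_0}{T_{\max}}\Big)\Big]. \] If $R_0>1$ and the unique infected equilibrium $E_2=(T_2,I_2,V_2)$ (with $T_2,I_2,V_2>0$) satisfies $a\le d+\frac{a}{T_{\max}}(T_2+I_2)$, then $E_2$ is globally asymptotically stable (with respect to solutions with positive initial data) for any $\tau\ge0$.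
   Context: When $R_0>1$ the system has a unique equilibrium with all components positive, called the infected equilibrium. *)

theory Defs
  imports Complex_Main
begin

definition T0 :: "real \<Rightarrow> real \<Rightarrow> real \<Rightarrow> real \<Rightarrow> real" where
  "T0 s d a Tmax = Tmax / (2 * a) * (a - d + sqrt ((a - d)^2 + 4 * a * s / Tmax))"

definition R0 :: "real \<Rightarrow> real \<Rightarrow> real \<Rightarrow> real \<Rightarrow> real \<Rightarrow> real \<Rightarrow> real \<Rightarrow> real \<Rightarrow> real" where
  "R0 s d a Tmax b mu p c =
     (1 / mu) * (b * p * T0 s d a Tmax / c + a * (1 - T0 s d a Tmax / Tmax))"

definition incid :: "real \<Rightarrow> real \<Rightarrow> real \<Rightarrow> real \<Rightarrow> real" where
  "incid b alpha x v = b * x * v / (1 + alpha * v)"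

definition is_equilibrium ::
  "real \<Rightarrow> real \<Rightarrow> real \<Rightarrow> real \<Rightarrow> real \<Rightarrow> real \<Rightarrow> real \<Rightarrow> real \<Rightarrow> real
   \<Rightarrow> real \<Rightarrow> real \<Rightarrow> real \<Rightarrow> bool" where
  "is_equilibrium s d a Tmax b alpha mu p c T2 I2 V2 \<longleftrightarrow>
     s - d * T2 + a * T2 * (1 - (T2 + I2) / Tmax) - incid b alpha T2 V2 = 0 \<and>
     incid b alpha T2 V2 + a * I2 * (1 - (T2 + I2) / Tmax) - mu * I2 = 0 \<and>
     p * I2 - c * V2 = 0"

definition is_solution ::
  "real \<Rightarrow> real \<Rightarrow> real \<Rightarrow> real \<Rightarrow> real \<Rightarrow> real \<Rightarrow> real \<Rightarrow> real \<Rightarrow> real \<Rightarrow> real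
   \<Rightarrow> (real \<Rightarrow> real) \<Rightarrow> (real \<Rightarrow> real) \<Rightarrow> (real \<Rightarrow> real) \<Rightarrow> bool" where
  "is_solution s d a Tmax b alpha mu p c tau T I V \<longleftrightarrow>
     continuous_on {-tau..} T \<and> continuous_on {-tau..} I \<and> continuous_on {-tau..} V \<and>
     (\<forall>t>0.
        (T has_real_derivative
           (s - d * T t + a * T t * (1 - (T t + I t) / Tmax) - incid b alpha (T t) (V t))) (at t) \<and>
        (I has_real_derivative
           (incid b alpha (T (t - tau)) (V (t - tau)) + a * I t * (1 - (T t + I t) / Tmax)
            - mu * I t)) (at t) \<and>
        (V has_real_derivative (p * I t - c * V t)) (at t))"

definition positive_initial ::
  "real \<Rightarrow> (real \<Rightarrow> real) \<Rightarrow> (real \<Rightarrow> real) \<Rightarrow> (real \<Rightarrow> real) \<Rightarrow> bool" where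
  "positive_initial tau T I V \<longleftrightarrow> (\<forall>\<theta>\<in>{-tau..0}. T \<theta> > 0 \<and> I \<theta> > 0 \<and> V \<theta> > 0)"

definition globally_asymptotically_stable ::
  "real \<Rightarrow> real \<Rightarrow> real \<Rightarrow> real \<Rightarrow> real \<Rightarrow> real \<Rightarrow> real \<Rightarrow> real \<Rightarrow> real \<Rightarrow> real
   \<Rightarrow> real \<Rightarrow> real \<Rightarrow> real \<Rightarrow> bool" where
  "globally_asymptotically_stable s d a Tmax b alpha mu p c tau T2 I2 V2 \<longleftrightarrow>
     (\<forall>\<epsilon>>0. \<exists>\<delta>>0. \<forall>T I V.
        is_solution s d a Tmax b alpha mu p c tau T I V \<and> positive_initial tau T I V \<and>
        (\<forall>\<theta>\<in>{-tau..0}. \<bar>T \<theta> - T2\<bar> < \<delta> \<and> \<bar>I \<theta> - I2\<bar> < \<delta> \<and> \<bar>V \<theta> - V2\<bar> < \<delta>)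
        \<longrightarrow> (\<forall>t\<ge>0. \<bar>T t - T2\<bar> < \<epsilon> \<and> \<bar>I t - I2\<bar> < \<epsilon> \<and> \<bar>V t - V2\<bar> < \<epsilon>)) \<and>
     (\<forall>T I V.
        is_solution s d a Tmax b alpha mu p c tau T I V \<and> positive_initial tau T I V
        \<longrightarrow> (T \<longlongrightarrow> T2) at_top \<and> (I \<longlongrightarrow> I2) at_top \<and> (V \<longlongrightarrow> V2) at_top)"

end

theory Submission
  imports Defs "HOL-Analysis.Analysis"
begin

text \<open>
  With \<open>g x = x - 1 - ln x\<close> and \<open>F(T, V) = b T V / (1 + \<alpha> V)\<close>, \<open>F\<^sub>2 = F(T\<^sub>2, V\<^sub>2)\<close>, the functional
  \<open>W = T\<^sub>2 g(T/T\<^sub>2) + I\<^sub>2 g(I/I\<^sub>2) + F\<^sub>2/(p I\<^sub>2) V\<^sub>2 g(V/V\<^sub>2)\<close> plus \<open>F\<^sub>2\<close> times the integral of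
  \<open>g(F(T, V)/F\<^sub>2)\<close> over \<open>[t - \<tau>, t]\<close> is a Lyapunov functional. The logistic terms contribute the complete square
  \<open>-(a/T\<^sub>m\<^sub>a\<^sub>x) (T + I - T\<^sub>2 - I\<^sub>2)\<^sup>2\<close> and a multiple of \<open>(T - T\<^sub>2)\<^sup>2/T\<close> whose sign is that of the hypothesis
  on \<open>a\<close>; the remaining terms add up to \<open>-F\<^sub>2\<close> times Volterra terms, among them \<open>g(T\<^sub>2/T)\<close>, and a
  negative multiple of \<open>(V - V\<^sub>2)\<^sup>2\<close>. So the dissipation controls \<open>T\<close>, \<open>V\<close> and \<open>T + I\<close> directly, and since \<open>W\<close>
  bounds the solution, hence its derivatives, no invariance principle is needed for convergence.
\<close>

definition volterra :: "real \<Rightarrow> real" where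
  "volterra x = x - 1 - ln x"

lemma volterra_nonneg: "x > 0 \<Longrightarrow> volterra x \<ge> 0"
  using ln_le_minus_one[of x] by (simp add: volterra_def)

lemma volterra_pos:
  assumes "x > 0" "x \<noteq> 1"
  shows "volterra x > 0"
  using volterra_nonneg[OF assms(1)] ln_eq_minus_one[OF assms(1)] assms(2)
  by (force simp: volterra_def)

lemma volterra_tangent:
  assumes "x > 0" "y > 0"
  shows "volterra y + (1 - 1 / y) * (x - y) \<le> volterra x"
proof -
  have "ln (x / y) \<le> x / y - 1"
    using assms by (intro ln_le_minus_one) simp
  then have "ln x - ln y \<le> x / y - 1"
    using assms by (simp add: ln_div)
  moreover have "(1 - 1 / y) * (x - y) = x - y - x / y + 1"
    using assms by (simp add: field_simps)
  ultimately show ?thesis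
    by (simp add: volterra_def)
qed

lemma volterra_small_imp_near_1:
  assumes "e > 0"
  obtains \<eta> where "\<eta> > 0" "\<And>x. x > 0 \<Longrightarrow> volterra x < \<eta> \<Longrightarrow> \<bar>x - 1\<bar> < e"
proof -
  define r where "r = min e (1 / 2)"
  have r: "0 < r" "r \<le> e" "r < 1"
    using assms by (auto simp: r_def)
  define \<eta> where "\<eta> = min (volterra (1 + r)) (volterra (1 - r))"
  have "\<eta> > 0"
    using r volterra_pos[of "1 + r"] volterra_pos[of "1 - r"] by (auto simp: \<eta>_def)
  moreover have "\<bar>x - 1\<bar> < e" if x: "x > 0" "volterra x < \<eta>" for x
  proof (rule ccontr)
    assume "\<not> \<bar>x - 1\<bar> < e"
    then consider "x \<ge> 1 + r" | "x \<le> 1 - r"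
      using r by linarith
    then show False
    proof cases
      case 1
      then have "0 \<le> (1 - 1 / (1 + r)) * (x - (1 + r))"
        using r by (intro mult_nonneg_nonneg) (auto simp: field_simps)
      then show False
        using volterra_tangent[of x "1 + r"] x r by (simp add: \<eta>_def)
    next
      case 2
      then have "0 \<le> (1 - 1 / (1 - r)) * (x - (1 - r))"
        using r by (intro mult_nonpos_nonpos) (auto simp: field_simps)
      then show False
        using volterra_tangent[of x "1 - r"] x r by (simp add: \<eta>_def)
    qed
  qed
  ultimately show ?thesis
    using that by blast
qed

lemma le_volterra_bound:
  assumes "x > 0"
  shows "x \<le> 2 * (volterra x + ln 2)"
  using volterra_tangent[of x 2] assms by (simp add: volterra_def field_simps)

lemma DERIV_volterra_scaled:
  assumes "(f has_real_derivative D) (at t)" "f t > 0" "k > 0"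
  shows "((\<lambda>t. k * volterra (f t / k)) has_real_derivative (1 - k / f t) * D) (at t)"
  unfolding volterra_def
  using assms by (auto intro!: derivative_eq_intros simp: field_simps)

lemma isCont_volterra: "x > 0 \<Longrightarrow> isCont volterra x"
  unfolding volterra_def by (auto intro!: continuous_intros)

lemma continuous_on_volterra [continuous_intros]:
  assumes "continuous_on S f" "\<And>x. x \<in> S \<Longrightarrow> f x > 0"
  shows "continuous_on S (\<lambda>x. volterra (f x))"
  unfolding volterra_def by (intro continuous_intros assms ballI) (use assms(2) in force)

lemma le_of_scaled_volterra_le:
  assumes "m > 0" "k > 0" "x > 0" "m * volterra (x / k) \<le> w"
  shows "x \<le> k * (2 * (w / m + ln 2))"
proof -
  have "volterra (x / k) \<le> w / m"
    using assms by (simp add: field_simps)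
  then have "x / k \<le> 2 * (w / m + ln 2)"
    using le_volterra_bound[of "x / k"] assms by simp
  then show ?thesis
    using assms by (simp add: field_simps)
qed

lemma scaled_volterra_small_imp_near:
  assumes "k > 0" "m > 0" "e > 0"
  obtains \<eta> where "\<eta> > 0" "\<And>x. x > 0 \<Longrightarrow> m * volterra (x / k) < \<eta> \<Longrightarrow> \<bar>x - k\<bar> < e"
proof -
  obtain \<eta> where \<eta>: "\<eta> > 0" "\<And>x. x > 0 \<Longrightarrow> volterra x < \<eta> \<Longrightarrow> \<bar>x - 1\<bar> < e / k"
    using volterra_small_imp_near_1[of "e / k"] assms by auto
  have "\<bar>x - k\<bar> < e" if x: "x > 0" "m * volterra (x / k) < m * \<eta>" for x
  proof -
    have "\<bar>x / k - 1\<bar> < e / k"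
      using \<eta>(2)[of "x / k"] x assms by simp
    moreover have "x / k - 1 = (x - k) / k"
      using assms by (simp add: field_simps)
    ultimately have "\<bar>x - k\<bar> / k < e / k"
      using assms by simp
    then show ?thesis
      using assms by (simp only: divide_less_cancel)
  qed
  then show ?thesis
    using that[of "m * \<eta>"] \<eta>(1) assms by simp
qed

lemma eventually_scaled_volterra_less:
  assumes "k > 0" "\<eta> > 0"
  shows "\<forall>\<^sub>F x in nhds k. m * volterra (x / k) < \<eta>"
proof -
  have "isCont (\<lambda>x. m * volterra (x / k)) k"
    using assms by (auto intro!: continuous_intros isCont_o2[OF _ isCont_volterra])
  then have "((\<lambda>x. m * volterra (x / k)) \<longlongrightarrow> 0) (nhds k)"
    using assms by (simp add: isCont_def tendsto_nhds_iff volterra_def)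
  then show ?thesis
    using assms by (intro order_tendstoD)
qed

lemma positive_at_right_end:
  fixes u :: "real \<Rightarrow> real"
  assumes "a \<le> b" "continuous_on {a..b} u" "u a > 0"
    and "\<And>t. a < t \<Longrightarrow> t < b \<Longrightarrow> \<exists>D. (u has_real_derivative D) (at t) \<and> D \<ge> - K * u t"
  shows "u b > 0"
proof -
  have "u a * exp (K * a) \<le> u b * exp (K * b)"
  proof (rule DERIV_nonneg_imp_increasing_open[OF assms(1)])
    fix t assume "a < t" "t < b"
    then obtain D where D: "(u has_real_derivative D) (at t)" "D \<ge> - K * u t"
      using assms(4) by blast
    have "((\<lambda>t. u t * exp (K * t)) has_real_derivative (D + K * u t) * exp (K * t)) (at t)"
      using D(1) by (auto intro!: derivative_eq_intros simp: algebra_simps)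
    then show "\<exists>y. ((\<lambda>t. u t * exp (K * t)) has_real_derivative y) (at t) \<and> 0 \<le> y"
      using D(2) by (intro exI[of _ "(D + K * u t) * exp (K * t)"]) auto
  qed (intro continuous_intros assms)
  moreover have "u a * exp (K * a) > 0"
    using assms(3) by simp
  ultimately have "u b * exp (K * b) > 0"
    by linarith
  then show ?thesis
    by (simp add: zero_less_mult_iff)
qed

text \<open>A Barbalat-type lemma: each excursion of a Lipschitz function away from its target lasts for
  a time bounded below, hence costs a fixed amount of the Lyapunov function.\<close>

lemma tendsto_of_dissipation:
  fixes X W :: "real \<Rightarrow> real"
  assumes W_nonneg: "\<And>t. t \<ge> r \<Longrightarrow> W t \<ge> 0"
    and W_deriv: "\<And>t. t \<ge> r \<Longrightarrow> \<exists>D. (W has_real_derivative D) (at t) \<and> D \<le> - \<phi> (X t)"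
    and \<phi>_nonneg: "\<And>t. t \<ge> r \<Longrightarrow> \<phi> (X t) \<ge> 0"
    and \<phi>_away: "\<And>e. e > 0 \<Longrightarrow> \<exists>\<eta>>0. \<forall>t\<ge>r. \<bar>X t - x\<bar> \<ge> e \<longrightarrow> \<phi> (X t) \<ge> \<eta>"
    and X_deriv: "\<And>t. t \<ge> r \<Longrightarrow> \<exists>D. (X has_real_derivative D) (at t) \<and> \<bar>D\<bar> \<le> L"
  shows "(X \<longlongrightarrow> x) at_top"
proof (rule tendstoI)
  fix e :: real assume "e > 0"
  then obtain \<eta> where \<eta>: "\<eta> > 0" "\<And>t. t \<ge> r \<Longrightarrow> \<bar>X t - x\<bar> \<ge> e / 2 \<Longrightarrow> \<phi> (X t) \<ge> \<eta>"
    using \<phi>_away[of "e / 2"] by auto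
  define h where "h = e / (2 * (\<bar>L\<bar> + 1))"
  have h: "h > 0" "h * (\<bar>L\<bar> + 1) = e / 2"
    using \<open>e > 0\<close> by (auto simp: h_def field_simps add_nonneg_eq_0_iff)
  have W_mono: "W v \<le> W u" if "r \<le> u" "u \<le> v" for u v
  proof (rule DERIV_nonpos_imp_nonincreasing[OF \<open>u \<le> v\<close>])
    fix t assume "u \<le> t" "t \<le> v"
    then have "t \<ge> r"
      using that by simp
    then show "\<exists>y. (W has_real_derivative y) (at t) \<and> y \<le> 0"
      using W_deriv[of t] \<phi>_nonneg[of t] by force
  qed
  define m where "m = Inf (W ` {r..})"
  have bdd: "bdd_below (W ` {r..})"
    using W_nonneg by (intro bdd_belowI[of _ 0]) auto
  have m_le: "m \<le> W t" if "t \<ge> r" for t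
    unfolding m_def using that bdd by (intro cInf_lower) auto
  have "\<exists>w\<in>W ` {r..}. w < m + \<eta> * h"
    unfolding m_def using \<eta>(1) h(1) by (intro cInf_lessD) auto
  then obtain t1 where t1: "t1 \<ge> r" "W t1 < m + \<eta> * h"
    by auto
  have "\<bar>X t - x\<bar> < e" if "t \<ge> t1" for t
  proof (rule ccontr)
    assume far: "\<not> \<bar>X t - x\<bar> < e"
    have X_close: "\<bar>X u - X t\<bar> \<le> e / 2" if u: "t \<le> u" "u \<le> t + h" for u
    proof -
      have "norm (X u - X t) \<le> (\<bar>L\<bar> + 1) * norm (u - t)"
      proof (rule field_differentiable_bound[where S = "{t..u}" and f' = "deriv X"])
        fix z assume "z \<in> {t..u}"
        then obtain D where D: "(X has_real_derivative D) (at z)" "\<bar>D\<bar> \<le> L"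
          using X_deriv[of z] \<open>t \<ge> t1\<close> t1(1) by auto
        then have "deriv X z = D"
          by (simp add: DERIV_imp_deriv)
        then show "(X has_real_derivative deriv X z) (at z within {t..u})" "norm (deriv X z) \<le> \<bar>L\<bar> + 1"
          using D by (auto intro: has_field_derivative_at_within)
      qed (use u in auto)
      also have "\<dots> \<le> (\<bar>L\<bar> + 1) * h"
        using u by (intro mult_left_mono) auto
      finally show ?thesis
        using h(2) by (simp add: mult.commute)
    qed
    have "W (t + h) + \<eta> * (t + h) \<le> W t + \<eta> * t"
    proof (rule DERIV_nonpos_imp_nonincreasing[where f = "\<lambda>u. W u + \<eta> * u"])
      fix u assume u: "t \<le> u" "u \<le> t + h"
      then have "u \<ge> r"
        using \<open>t \<ge> t1\<close> t1(1) by simp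
      then obtain D where D: "(W has_real_derivative D) (at u)" "D \<le> - \<phi> (X u)"
        using W_deriv by blast
      have "\<bar>X u - x\<bar> \<ge> e / 2"
        using X_close[OF u] far by linarith
      then have "\<phi> (X u) \<ge> \<eta>"
        using \<eta>(2) \<open>u \<ge> r\<close> by blast
      then show "\<exists>y. ((\<lambda>u. W u + \<eta> * u) has_real_derivative y) (at u) \<and> y \<le> 0"
        using D by (intro exI[of _ "D + \<eta>"]) (auto intro!: derivative_eq_intros)
    qed (use h in simp)
    then have "W (t + h) \<le> W t - \<eta> * h"
      by (simp add: algebra_simps)
    then show False
      using t1 W_mono[of t1 t] m_le[of "t + h"] \<open>t \<ge> t1\<close> h(1) by linarith
  qed
  then show "\<forall>\<^sub>F t in at_top. dist (X t) x < e"
    unfolding eventually_at_top_linorder dist_real_def by blast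
qed

locale infected_equilibrium =
  fixes s d a Tmax b alpha mu p c tau T2 I2 V2 :: real
  assumes pos: "s > 0" "d > 0" "a > 0" "Tmax > 0" "b > 0" "alpha > 0" "mu > 0" "p > 0" "c > 0"
    and tau_nonneg: "tau \<ge> 0"
    and eq_pos: "T2 > 0" "I2 > 0" "V2 > 0"
    and equilibrium: "is_equilibrium s d a Tmax b alpha mu p c T2 I2 V2"
    and growth_le: "a \<le> d + a / Tmax * (T2 + I2)"
begin

abbreviation F where "F \<equiv> incid b alpha"

abbreviation F2 where "F2 \<equiv> F T2 V2"

lemma F_pos: "x > 0 \<Longrightarrow> v > 0 \<Longrightarrow> F x v > 0"
  using pos by (simp add: incid_def add_pos_pos)

lemma F_le:
  assumes "x \<ge> 0" "v \<ge> 0"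
  shows "F x v \<le> b / alpha * x"
proof -
  have "alpha * v \<le> 1 + alpha * v"
    by simp
  then have "v / (1 + alpha * v) \<le> 1 / alpha"
    using pos assms by (simp add: field_simps add_pos_nonneg)
  then have "b * x * (v / (1 + alpha * v)) \<le> b * x * (1 / alpha)"
    using pos assms by (intro mult_left_mono) auto
  then show ?thesis
    by (simp add: incid_def)
qed

lemma F2_pos: "F2 > 0"
  using F_pos eq_pos by blast

lemma s_eq: "s = d * T2 - a * T2 * (1 - (T2 + I2) / Tmax) + F2"
  and mu_eq: "mu = F2 / I2 + a * (1 - (T2 + I2) / Tmax)"
  and c_eq: "c = p * I2 / V2"
proof -
  have eq: "s - d * T2 + a * T2 * (1 - (T2 + I2) / Tmax) - F2 = 0"
    "F2 + a * I2 * (1 - (T2 + I2) / Tmax) - mu * I2 = 0" "p * I2 - c * V2 = 0"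
    using equilibrium by (simp_all add: is_equilibrium_def)
  show "s = d * T2 - a * T2 * (1 - (T2 + I2) / Tmax) + F2"
    using eq(1) by linarith
  have "mu = (F2 + I2 * (a * (1 - (T2 + I2) / Tmax))) / I2"
    using eq(2) eq_pos by (simp add: eq_divide_eq ac_simps)
  then show "mu = F2 / I2 + a * (1 - (T2 + I2) / Tmax)"
    using eq_pos by (simp add: add_divide_distrib)
  show "c = p * I2 / V2"
    using eq(3) eq_pos by (simp add: eq_divide_eq)
qed

lemma dissipation_T:
  assumes "x > 0"
  shows "(1 - T2 / x) * (s - d * x + a * x * (1 - (x + y) / Tmax) - X)
    = - (d - a + a / Tmax * (T2 + I2)) * ((x - T2)\<^sup>2 / x)
      - a / Tmax * ((x - T2) * (x + y - T2 - I2)) + (1 - T2 / x) * (F2 - X)"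
proof -
  have "s - d * x + a * x * (1 - (x + y) / Tmax) - X
      = - (d - a + a / Tmax * (T2 + I2)) * (x - T2) - a / Tmax * (x * (x + y - T2 - I2)) + (F2 - X)"
    using pos unfolding s_eq by (simp add: field_simps)
  moreover have "(1 - T2 / x) * (x - T2) = (x - T2)\<^sup>2 / x" "(1 - T2 / x) * x = x - T2"
    using assms by (simp_all add: field_simps power2_eq_square)
  moreover have "A * (- K * u - m * (x * w) + R) = - K * (A * u) - m * ((A * x) * w) + A * R"
    for A K u m w R :: real
    by (simp add: algebra_simps)
  ultimately show ?thesis
    by metis
qed

lemma dissipation_I:
  assumes "y > 0"
  shows "(1 - I2 / y) * (Z + a * y * (1 - (x + y) / Tmax) - mu * y)
    = - a / Tmax * ((y - I2) * (x + y - T2 - I2)) + (1 - I2 / y) * (Z - F2 * (y / I2))"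
proof -
  have "Z + a * y * (1 - (x + y) / Tmax) - mu * y
      = - a / Tmax * (y * (x + y - T2 - I2)) + (Z - F2 * (y / I2))"
    using pos eq_pos unfolding mu_eq by (simp add: field_simps)
  moreover have "(1 - I2 / y) * y = y - I2"
    using assms by (simp add: field_simps)
  moreover have "A * (m * (y * w) + R) = m * ((A * y) * w) + A * R" for A m w R :: real
    by (simp add: algebra_simps)
  ultimately show ?thesis
    by metis
qed

lemma dissipation_V:
  "F2 / (p * I2) * ((1 - V2 / v) * (p * y - c * v)) = F2 * ((1 - V2 / v) * (y / I2 - v / V2))"
  using pos eq_pos unfolding c_eq by (simp add: field_simps)

text \<open>The four Volterra terms have arguments whose product is the ratio of the delayed to the
  current incidence, which absorbs the logarithms; the remainder is the saturation term.\<close>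

lemma dissipation_incidence:
  assumes "x > 0" "y > 0" "v > 0" "Z > 0"
  shows "(1 - T2 / x) * (1 - F x v / F2) + (1 - I2 / y) * (Z / F2 - y / I2)
      + (1 - V2 / v) * (y / I2 - v / V2) + volterra (F x v / F2) - volterra (Z / F2)
    = - (volterra (T2 / x) + volterra (Z / F2 * (I2 / y)) + volterra (y / I2 * (V2 / v))
         + volterra ((1 + alpha * v) / (1 + alpha * V2)))
      - alpha * (v - V2)\<^sup>2 / (V2 * (1 + alpha * V2) * (1 + alpha * v))"
proof -
  define k k2 where "k = 1 + alpha * v" and "k2 = 1 + alpha * V2"
  have k: "k > 0" "k2 > 0"
    using pos eq_pos assms by (auto simp: k_def k2_def add_pos_pos)
  have q: "F x v / F2 = (x / T2) * (v / V2) * (k2 / k)"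
    using pos eq_pos unfolding incid_def k_def[symmetric] k2_def[symmetric] by (simp add: ac_simps)
  have t: "T2 / x * (F x v / F2) = (v / V2) * (k2 / k)"
    unfolding q using eq_pos assms by simp
  have m: "(I2 / y) * (y / I2) = 1" "(V2 / v) * (v / V2) = 1"
    using eq_pos assms by auto
  have lnq: "ln (F x v / F2) = ln x - ln T2 + ln v - ln V2 + ln k2 - ln k"
    unfolding q using eq_pos assms k by (simp add: ln_mult ln_div)
  have lns: "ln (T2 / x) = ln T2 - ln x" "ln (Z / F2 * (I2 / y)) = ln (Z / F2) + ln I2 - ln y"
    "ln (y / I2 * (V2 / v)) = ln y - ln I2 + ln V2 - ln v" "ln (k / k2) = ln k - ln k2"
    using eq_pos assms k F2_pos by (simp_all add: ln_mult ln_div)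
  have "k / k2 - 1 + (v / V2) * (k2 / k) - v / V2 = (k - k2) * (k * V2 - v * k2) / (V2 * k2 * k)"
    using k eq_pos by (simp add: field_simps)
  also have "(k - k2) * (k * V2 - v * k2) = - alpha * (v - V2)\<^sup>2"
    unfolding k_def k2_def by (simp add: algebra_simps power2_eq_square)
  finally have sat: "k / k2 - 1 + (v / V2) * (k2 / k) - v / V2
      = - alpha * (v - V2)\<^sup>2 / (V2 * k2 * k)" .
  have "(1 - T2 / x) * (1 - F x v / F2) = 1 - F x v / F2 - T2 / x + (v / V2) * (k2 / k)"
    unfolding t[symmetric] by (simp only: left_diff_distrib right_diff_distrib)
  moreover have "(1 - I2 / y) * (Z / F2 - y / I2) = Z / F2 - y / I2 - Z / F2 * (I2 / y) + 1"
    unfolding left_diff_distrib right_diff_distrib m by (simp add: mult.commute)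
  moreover have "(1 - V2 / v) * (y / I2 - v / V2) = y / I2 - v / V2 - y / I2 * (V2 / v) + 1"
    unfolding left_diff_distrib right_diff_distrib m by (simp add: mult.commute)
  ultimately show ?thesis
    using sat unfolding volterra_def lnq lns k_def[symmetric] k2_def[symmetric] by simp
qed

definition dissipation :: "real \<Rightarrow> real \<Rightarrow> real \<Rightarrow> real" where
  "dissipation x y v = a / Tmax * (x + y - T2 - I2)\<^sup>2 + F2 * volterra (T2 / x)
     + F2 * (alpha * (v - V2)\<^sup>2 / (V2 * (1 + alpha * V2) * (1 + alpha * v)))"

lemma dissipation_terms_nonneg:
  assumes "x > 0" "v > 0"
  shows "a / Tmax * (x + y - T2 - I2)\<^sup>2 \<ge> 0" "F2 * volterra (T2 / x) \<ge> 0"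
    "F2 * (alpha * (v - V2)\<^sup>2 / (V2 * (1 + alpha * V2) * (1 + alpha * v))) \<ge> 0"
  using assms pos eq_pos F2_pos volterra_nonneg[of "T2 / x"]
  by (auto intro!: mult_nonneg_nonneg divide_nonneg_pos mult_pos_pos add_pos_pos)

lemma lyapunov_derivative_le:
  assumes "x > 0" "y > 0" "v > 0" "Z > 0"
  shows "(1 - T2 / x) * (s - d * x + a * x * (1 - (x + y) / Tmax) - F x v)
      + (1 - I2 / y) * (Z + a * y * (1 - (x + y) / Tmax) - mu * y)
      + F2 / (p * I2) * ((1 - V2 / v) * (p * y - c * v))
      + F2 * (volterra (F x v / F2) - volterra (Z / F2))
    \<le> - dissipation x y v" (is "?L \<le> _")
proof -
  define N where "N = (d - a + a / Tmax * (T2 + I2)) * ((x - T2)\<^sup>2 / x)"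
  define P where "P = volterra (Z / F2 * (I2 / y)) + volterra (y / I2 * (V2 / v))
         + volterra ((1 + alpha * v) / (1 + alpha * V2))"
  have "N \<ge> 0"
    unfolding N_def using growth_le assms by (intro mult_nonneg_nonneg) auto
  have "P \<ge> 0"
    unfolding P_def using assms pos eq_pos F2_pos
    by (intro add_nonneg_nonneg volterra_nonneg) (auto intro!: divide_pos_pos mult_pos_pos add_pos_pos)
  then have "F2 * P \<ge> 0"
    using F2_pos by simp
  have split: "(1 - T2 / x) * (F2 - F x v) = F2 * ((1 - T2 / x) * (1 - F x v / F2))"
    "(1 - I2 / y) * (Z - F2 * (y / I2)) = F2 * ((1 - I2 / y) * (Z / F2 - y / I2))"
  proof -
    have "F2 * (1 - F x v / F2) = F2 - F x v" "F2 * (Z / F2 - y / I2) = Z - F2 * (y / I2)"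
      using F2_pos by (simp_all add: right_diff_distrib)
    then show "(1 - T2 / x) * (F2 - F x v) = F2 * ((1 - T2 / x) * (1 - F x v / F2))"
      "(1 - I2 / y) * (Z - F2 * (y / I2)) = F2 * ((1 - I2 / y) * (Z / F2 - y / I2))"
      by (metis mult.left_commute)+
  qed
  have "?L = - N - a / Tmax * ((x - T2) * (x + y - T2 - I2)) - a / Tmax * ((y - I2) * (x + y - T2 - I2))
     + F2 * ((1 - T2 / x) * (1 - F x v / F2) + (1 - I2 / y) * (Z / F2 - y / I2)
      + (1 - V2 / v) * (y / I2 - v / V2) + volterra (F x v / F2) - volterra (Z / F2))"
    unfolding dissipation_T[OF assms(1)] dissipation_I[OF assms(2)] dissipation_V split
      minus_mult_left[symmetric] N_def[symmetric]
    by (simp add: distrib_left right_diff_distrib)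
  also have "\<dots> = - N - a / Tmax * (x + y - T2 - I2)\<^sup>2 - F2 * volterra (T2 / x) - F2 * P
     - F2 * (alpha * (v - V2)\<^sup>2 / (V2 * (1 + alpha * V2) * (1 + alpha * v)))"
    unfolding dissipation_incidence[OF assms] P_def by (simp add: algebra_simps power2_eq_square)
  also have "\<dots> \<le> - dissipation x y v"
    using \<open>N \<ge> 0\<close> \<open>F2 * P \<ge> 0\<close> unfolding dissipation_def by linarith
  finally show ?thesis .
qed

end

locale positive_solution = infected_equilibrium +
  fixes T I V :: "real \<Rightarrow> real"
  assumes solution: "is_solution s d a Tmax b alpha mu p c tau T I V"
    and initial: "positive_initial tau T I V"
begin

lemma continuous_TIV:
  assumes "S \<subseteq> {-tau..}"
  shows "continuous_on S T" "continuous_on S I" "continuous_on S V"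
  using solution assms unfolding is_solution_def by (auto intro: continuous_on_subset)

lemma DERIV_TIV:
  assumes "t > 0"
  shows "(T has_real_derivative s - d * T t + a * T t * (1 - (T t + I t) / Tmax) - F (T t) (V t)) (at t)"
    "(I has_real_derivative F (T (t - tau)) (V (t - tau)) + a * I t * (1 - (T t + I t) / Tmax) - mu * I t) (at t)"
    "(V has_real_derivative p * I t - c * V t) (at t)"
  using solution assms unfolding is_solution_def by auto

lemma positive_until:
  assumes "t1 \<ge> 0"
    and before: "\<And>t. -tau \<le> t \<Longrightarrow> t < t1 \<Longrightarrow> T t > 0 \<and> I t > 0 \<and> V t > 0"
  shows "T t1 > 0 \<and> I t1 > 0 \<and> V t1 > 0"
proof -
  have sub: "{0..t1} \<subseteq> {-tau..}"
    using tau_nonneg by auto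
  note cont = continuous_TIV[OF sub]
  have init: "T 0 > 0" "I 0 > 0" "V 0 > 0"
    using initial tau_nonneg by (auto simp: positive_initial_def)
  have "\<exists>x\<in>{0..t1}. \<forall>y\<in>{0..t1}. T y + I y \<le> T x + I x"
    using \<open>t1 \<ge> 0\<close> by (intro continuous_attains_sup continuous_on_add cont) auto
  then obtain B where B: "\<And>t. t \<in> {0..t1} \<Longrightarrow> T t + I t \<le> B"
    by blast
  have crowd: "a * u * (1 - (T t + I t) / Tmax) \<ge> - (a * B / Tmax) * u" if "0 < t" "t < t1" "u > 0" for t u
  proof -
    have "(T t + I t) / Tmax \<le> B / Tmax"
      using B[of t] that pos by (intro divide_right_mono) auto
    then have "a * u * (1 - (T t + I t) / Tmax) \<ge> a * u * (- (B / Tmax))"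
      using pos that by (intro mult_left_mono) auto
    then show ?thesis
      by (simp add: ac_simps)
  qed
  have "T t1 > 0"
  proof (rule positive_at_right_end[OF \<open>t1 \<ge> 0\<close> cont(1) init(1)])
    fix t assume t: "0 < t" "t < t1"
    then have p: "T t > 0" "V t > 0"
      using before[of t] tau_nonneg by auto
    have "s - d * T t + a * T t * (1 - (T t + I t) / Tmax) - F (T t) (V t)
        \<ge> - (d + a * B / Tmax + b / alpha) * T t"
      using crowd[OF t p(1)] F_le[of "T t" "V t"] p pos(1) by (simp add: left_diff_distrib)
    then show "\<exists>D. (T has_real_derivative D) (at t) \<and> D \<ge> - (d + a * B / Tmax + b / alpha) * T t"
      using DERIV_TIV(1)[OF t(1)] by blast
  qed
  moreover have "I t1 > 0"
  proof (rule positive_at_right_end[OF \<open>t1 \<ge> 0\<close> cont(2) init(2)])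
    fix t assume t: "0 < t" "t < t1"
    then have p: "I t > 0" "F (T (t - tau)) (V (t - tau)) > 0"
      using before[of t] before[of "t - tau"] tau_nonneg F_pos by auto
    have "F (T (t - tau)) (V (t - tau)) + a * I t * (1 - (T t + I t) / Tmax) - mu * I t
        \<ge> - (a * B / Tmax + mu) * I t"
      using crowd[OF t p(1)] p by (simp add: left_diff_distrib)
    then show "\<exists>D. (I has_real_derivative D) (at t) \<and> D \<ge> - (a * B / Tmax + mu) * I t"
      using DERIV_TIV(2)[OF t(1)] by blast
  qed
  moreover have "V t1 > 0"
  proof (rule positive_at_right_end[OF \<open>t1 \<ge> 0\<close> cont(3) init(3)])
    fix t assume t: "0 < t" "t < t1"
    then have "p * I t > 0"
      using before[of t] tau_nonneg pos by auto
    then show "\<exists>D. (V has_real_derivative D) (at t) \<and> D \<ge> - c * V t"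
      using DERIV_TIV(3)[OF t(1)] by (intro exI[of _ "p * I t - c * V t"]) simp
  qed
  ultimately show ?thesis
    by blast
qed

lemma TIV_pos:
  assumes "t \<ge> -tau"
  shows "T t > 0" "I t > 0" "V t > 0"
proof -
  define Z where "Z = {t \<in> {0..}. min (T t) (min (I t) (V t)) \<le> 0}"
  have "Z = {}"
  proof (rule ccontr)
    assume ne: "Z \<noteq> {}"
    have sub: "{0..} \<subseteq> {-tau..}"
      using tau_nonneg by auto
    have "closed Z"
      unfolding Z_def
      by (intro continuous_on_closed_Collect_le continuous_on_min continuous_TIV[OF sub] continuous_intros)
    moreover have bdd: "bdd_below Z"
      by (intro bdd_belowI[of _ 0]) (auto simp: Z_def)
    ultimately have Inf_in: "Inf Z \<in> Z"
      using ne closed_contains_Inf by blast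
    have "T (Inf Z) > 0 \<and> I (Inf Z) > 0 \<and> V (Inf Z) > 0"
    proof (rule positive_until)
      fix t assume t: "-tau \<le> t" "t < Inf Z"
      show "T t > 0 \<and> I t > 0 \<and> V t > 0"
      proof (cases "t \<le> 0")
        case True
        then show ?thesis
          using initial t by (auto simp: positive_initial_def)
      next
        case False
        moreover have "t \<notin> Z"
          using cInf_lower[OF _ bdd, of t] t by auto
        ultimately show ?thesis
          by (auto simp: Z_def)
      qed
    qed (use Inf_in in \<open>simp add: Z_def\<close>)
    then have "min (T (Inf Z)) (min (I (Inf Z)) (V (Inf Z))) > 0"
      by simp
    moreover have "min (T (Inf Z)) (min (I (Inf Z)) (V (Inf Z))) \<le> 0"
      using Inf_in unfolding Z_def by blast
    ultimately show False
      by linarith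
  qed
  then have "T t > 0 \<and> I t > 0 \<and> V t > 0"
  proof (cases "t \<le> 0")
    case True
    then show ?thesis
      using initial assms by (auto simp: positive_initial_def)
  next
    case False
    then have "t \<notin> Z"
      using \<open>Z = {}\<close> by simp
    then show ?thesis
      using False by (auto simp: Z_def)
  qed
  then show "T t > 0" "I t > 0" "V t > 0"
    by auto
qed

definition G :: "real \<Rightarrow> real" where
  "G t = integral {-tau..t} (\<lambda>\<theta>. volterra (F (T \<theta>) (V \<theta>) / F2))"

definition W :: "real \<Rightarrow> real" where
  "W t = T2 * volterra (T t / T2) + I2 * volterra (I t / I2)
     + F2 / (p * I2) * (V2 * volterra (V t / V2)) + F2 * (G t - G (t - tau))"

lemma continuous_volterra_F:
  assumes "S \<subseteq> {-tau..}"
  shows "continuous_on S (\<lambda>\<theta>. volterra (F (T \<theta>) (V \<theta>) / F2))"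
proof (rule continuous_on_volterra)
  have "1 + alpha * V \<theta> \<noteq> 0" if "\<theta> \<in> S" for \<theta>
  proof -
    have "alpha * V \<theta> > 0"
      using TIV_pos(3)[of \<theta>] that assms pos(6) by auto
    then show ?thesis
      by linarith
  qed
  then show "continuous_on S (\<lambda>\<theta>. F (T \<theta>) (V \<theta>) / F2)"
    unfolding incid_def[of _ _ "T _"] using F2_pos
    by (intro continuous_intros continuous_TIV[OF assms] ballI) auto
  show "F (T \<theta>) (V \<theta>) / F2 > 0" if "\<theta> \<in> S" for \<theta>
    using TIV_pos[of \<theta>] that assms F_pos F2_pos by auto
qed

lemma continuous_G: "continuous_on {-tau..t} G"
  unfolding G_def
  by (intro indefinite_integral_continuous_1 integrable_continuous_real continuous_volterra_F) auto

lemma DERIV_G: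
  assumes "t > -tau"
  shows "(G has_real_derivative volterra (F (T t) (V t) / F2)) (at t)"
proof -
  have "(G has_real_derivative volterra (F (T t) (V t) / F2)) (at t within {-tau..t + 1})"
    unfolding G_def using assms
    by (intro integral_has_real_derivative continuous_volterra_F) auto
  then show ?thesis
    using assms by (simp add: at_within_Icc_at)
qed

lemma G_diff:
  assumes "t \<ge> 0"
  shows "G t - G (t - tau) = integral {t - tau..t} (\<lambda>\<theta>. volterra (F (T \<theta>) (V \<theta>) / F2))"
proof -
  have "G (t - tau) + integral {t - tau..t} (\<lambda>\<theta>. volterra (F (T \<theta>) (V \<theta>) / F2)) = G t"
    unfolding G_def using assms tau_nonneg
    by (intro Henstock_Kurzweil_Integration.integral_combine integrable_continuous_real
        continuous_volterra_F) auto
  then show ?thesis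
    by simp
qed

lemma G_diff_nonneg:
  assumes "t \<ge> 0"
  shows "G t - G (t - tau) \<ge> 0"
  unfolding G_diff[OF assms]
proof (rule integral_nonneg)
  show "(\<lambda>\<theta>. volterra (F (T \<theta>) (V \<theta>) / F2)) integrable_on {t - tau..t}"
    using assms by (intro integrable_continuous_real continuous_volterra_F) auto
  show "volterra (F (T \<theta>) (V \<theta>) / F2) \<ge> 0" if "\<theta> \<in> {t - tau..t}" for \<theta>
    using TIV_pos[of \<theta>] that assms F_pos F2_pos by (intro volterra_nonneg) auto
qed

lemma G_diff_0_le:
  assumes "\<And>\<theta>. \<theta> \<in> {-tau..0} \<Longrightarrow> volterra (F (T \<theta>) (V \<theta>) / F2) \<le> m"
  shows "G 0 - G (0 - tau) \<le> tau * m"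
proof -
  have "G 0 - G (0 - tau) \<le> integral {0 - tau..0} (\<lambda>_. m)"
    unfolding G_diff[OF order_refl] using assms
    by (intro integral_le integrable_continuous_real continuous_volterra_F continuous_intros) auto
  then show ?thesis
    using tau_nonneg by simp
qed

lemma DERIV_W:
  assumes "t > 0"
  obtains D where "(W has_real_derivative D) (at t)" "D \<le> - dissipation (T t) (I t) (V t)"
proof -
  have t: "t > -tau" "t - tau > -tau"
    using assms tau_nonneg by auto
  note p = TIV_pos[OF less_imp_le[OF t(1)]] and q = TIV_pos[OF less_imp_le[OF t(2)]]
  note ders = DERIV_TIV[OF assms]
  have Gd: "((\<lambda>t. G (t - tau)) has_real_derivative volterra (F (T (t - tau)) (V (t - tau)) / F2)) (at t)"
    using DERIV_shift[of G _ t "- tau"] DERIV_G[OF t(2)] by simp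
  note D = DERIV_add[OF DERIV_add[OF DERIV_add[OF
        DERIV_volterra_scaled[OF ders(1) p(1) eq_pos(1)]
        DERIV_volterra_scaled[OF ders(2) p(2) eq_pos(2)]]
        DERIV_cmult[OF DERIV_volterra_scaled[OF ders(3) p(3) eq_pos(3)], of "F2 / (p * I2)"]]
      DERIV_cmult[OF DERIV_diff[OF DERIV_G[OF t(1)] Gd], of F2]]
  show ?thesis
    by (rule that[OF D[folded W_def]], rule lyapunov_derivative_le) (use p q F_pos in auto)
qed

lemma W_terms_nonneg:
  assumes "t \<ge> 0"
  shows "T2 * volterra (T t / T2) \<ge> 0" "I2 * volterra (I t / I2) \<ge> 0"
    "F2 / (p * I2) * (V2 * volterra (V t / V2)) \<ge> 0" "F2 * (G t - G (t - tau)) \<ge> 0"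
proof -
  have "T t > 0" "I t > 0" "V t > 0"
    using TIV_pos[of t] assms tau_nonneg by auto
  then have "volterra (T t / T2) \<ge> 0" "volterra (I t / I2) \<ge> 0" "volterra (V t / V2) \<ge> 0"
    using eq_pos by (auto intro: volterra_nonneg)
  then show "T2 * volterra (T t / T2) \<ge> 0" "I2 * volterra (I t / I2) \<ge> 0"
    "F2 / (p * I2) * (V2 * volterra (V t / V2)) \<ge> 0" "F2 * (G t - G (t - tau)) \<ge> 0"
    using pos eq_pos F2_pos G_diff_nonneg[OF assms] by simp_all
qed

lemma W_le_W0:
  assumes "t \<ge> 0"
  shows "W t \<le> W 0"
proof (rule DERIV_nonpos_imp_decreasing_open[OF assms])
  fix u assume u: "0 < u" "u < t"
  then have p: "T u > 0" "V u > 0"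
    using TIV_pos[of u] tau_nonneg by auto
  have "dissipation (T u) (I u) (V u) \<ge> 0"
    unfolding dissipation_def
    using dissipation_terms_nonneg(1)[OF p, of "I u"] dissipation_terms_nonneg(2,3)[OF p] by linarith
  moreover obtain D where "(W has_real_derivative D) (at u)" "D \<le> - dissipation (T u) (I u) (V u)"
    using DERIV_W[OF u(1)] by blast
  ultimately show "\<exists>y. (W has_real_derivative y) (at u) \<and> y \<le> 0"
    by (intro exI[of _ D]) simp
next
  have sub: "{0..t} \<subseteq> {-tau..}" "{0..t} \<subseteq> {-tau..t}" "(\<lambda>u. u - tau) ` {0..t} \<subseteq> {-tau..t}"
    using tau_nonneg by auto
  have "continuous_on {0..t} (\<lambda>u. G (u - tau))"
    by (rule continuous_on_compose2[OF continuous_G _ sub(3)]) (intro continuous_intros)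
  then show "continuous_on {0..t} W"
    unfolding W_def using eq_pos TIV_pos tau_nonneg
    by (intro continuous_intros continuous_TIV[OF sub(1)] continuous_on_subset[OF continuous_G sub(2)]) auto
qed

lemma W_terms_le:
  assumes "t \<ge> 0"
  shows "T2 * volterra (T t / T2) \<le> W 0" "I2 * volterra (I t / I2) \<le> W 0"
    "F2 / (p * I2) * V2 * volterra (V t / V2) \<le> W 0"
  using W_le_W0[OF assms] W_terms_nonneg[OF assms] unfolding W_def[of t]
  by (linarith, linarith, simp)

lemma bounded:
  obtains B where "B > 0" "\<And>t. t \<ge> 0 \<Longrightarrow> T t \<le> B \<and> I t \<le> B \<and> V t \<le> B"
proof -
  have k: "F2 / (p * I2) * V2 > 0"
    using F2_pos pos eq_pos by simp
  define x y z where "x = T2 * (2 * (W 0 / T2 + ln 2))" and "y = I2 * (2 * (W 0 / I2 + ln 2))"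
    and "z = V2 * (2 * (W 0 / (F2 / (p * I2) * V2) + ln 2))"
  have "T t \<le> x \<and> I t \<le> y \<and> V t \<le> z" if "t \<ge> 0" for t
    unfolding x_def y_def z_def using TIV_pos[of t] that tau_nonneg
    by (intro conjI le_of_scaled_volterra_le eq_pos k W_terms_le) auto
  then show ?thesis
    by (intro that[of "max 1 (max x (max y z))"]) (force simp: le_max_iff_disj)+
qed

lemma bounded_derivatives:
  obtains L where "\<And>t. t \<ge> tau + 1 \<Longrightarrow> \<exists>D. (T has_real_derivative D) (at t) \<and> \<bar>D\<bar> \<le> L"
    "\<And>t. t \<ge> tau + 1 \<Longrightarrow> \<exists>D. (V has_real_derivative D) (at t) \<and> \<bar>D\<bar> \<le> L"
    "\<And>t. t \<ge> tau + 1 \<Longrightarrow> \<exists>D. ((\<lambda>t. T t + I t) has_real_derivative D) (at t) \<and> \<bar>D\<bar> \<le> L"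
proof -
  obtain B where B: "B > 0" "\<And>t. t \<ge> 0 \<Longrightarrow> T t \<le> B \<and> I t \<le> B \<and> V t \<le> B"
    using bounded by blast
  define C where "C = a * B * (1 + 2 * B / Tmax)"
  define LT where "LT = s + d * B + C + b / alpha * B"
  define LI where "LI = b / alpha * B + C + mu * B"
  define LV where "LV = p * B + c * B"
  have bounds: "\<bar>s - d * T t + a * T t * (1 - (T t + I t) / Tmax) - F (T t) (V t)\<bar> \<le> LT \<and>
    \<bar>F (T (t - tau)) (V (t - tau)) + a * I t * (1 - (T t + I t) / Tmax) - mu * I t\<bar> \<le> LI \<and>
    \<bar>p * I t - c * V t\<bar> \<le> LV" if "t \<ge> tau + 1" for t
  proof -
    have t: "t \<ge> 0" "t - tau \<ge> 0" "t \<ge> -tau" "t - tau \<ge> -tau"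
      using that tau_nonneg by auto
    note p = TIV_pos[OF t(3)] TIV_pos[OF t(4)]
    have le: "T t \<le> B" "I t \<le> B" "V t \<le> B" "T (t - tau) \<le> B"
      using B(2)[OF t(1)] B(2)[OF t(2)] by auto
    have "(T t + I t) / Tmax \<le> 2 * B / Tmax" "(T t + I t) / Tmax \<ge> 0"
      using le p pos by (auto intro!: divide_right_mono)
    then have m: "\<bar>1 - (T t + I t) / Tmax\<bar> \<le> 1 + 2 * B / Tmax"
      by linarith
    have crowd: "\<bar>a * u * (1 - (T t + I t) / Tmax)\<bar> \<le> C" if "0 < u" "u \<le> B" for u
      unfolding C_def abs_mult[of "a * u"] using that pos m
      by (intro mult_mono) auto
    have inc: "F x v \<le> b / alpha * B \<and> F x v > 0" if "0 < x" "x \<le> B" "0 < v" for x v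
    proof -
      have "b / alpha * x \<le> b / alpha * B"
        using pos that by (intro mult_left_mono) auto
      then show ?thesis
        using F_le[of x v] F_pos[of x v] that by auto
    qed
    have lin: "0 \<le> k * u \<and> k * u \<le> k * B" if "0 < k" "0 < u" "u \<le> B" for k u
      using that by simp
    have "\<bar>s - d * T t + a * T t * (1 - (T t + I t) / Tmax) - F (T t) (V t)\<bar> \<le> LT"
      unfolding LT_def
      using crowd[OF p(1) le(1)] inc[OF p(1) le(1) p(3)] lin[OF pos(2) p(1) le(1)] pos(1) by linarith
    moreover have "\<bar>F (T (t - tau)) (V (t - tau)) + a * I t * (1 - (T t + I t) / Tmax) - mu * I t\<bar> \<le> LI"
      unfolding LI_def
      using crowd[OF p(2) le(2)] inc[OF p(4) le(4) p(6)] lin[OF pos(7) p(2) le(2)] by linarith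
    moreover have "\<bar>p * I t - c * V t\<bar> \<le> LV"
      unfolding LV_def using lin[OF pos(8) p(2) le(2)] lin[OF pos(9) p(3) le(3)] by linarith
    ultimately show ?thesis
      by blast
  qed
  show ?thesis
  proof (rule that[of "max LV (LT + LI)"])
    fix t assume t: "t \<ge> tau + 1"
    then have "t > 0"
      using tau_nonneg by simp
    note D = DERIV_TIV[OF this]
    have b: "\<bar>s - d * T t + a * T t * (1 - (T t + I t) / Tmax) - F (T t) (V t)\<bar> \<le> LT"
      "\<bar>F (T (t - tau)) (V (t - tau)) + a * I t * (1 - (T t + I t) / Tmax) - mu * I t\<bar> \<le> LI"
      "\<bar>p * I t - c * V t\<bar> \<le> LV"
      using bounds[OF t] by auto
    have max: "LV \<le> max LV (LT + LI)" "LT + LI \<le> max LV (LT + LI)"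
      by auto
    show "\<exists>D. (T has_real_derivative D) (at t) \<and> \<bar>D\<bar> \<le> max LV (LT + LI)"
      by (intro exI, rule conjI, rule D(1)) (use b max in linarith)
    show "\<exists>D. (V has_real_derivative D) (at t) \<and> \<bar>D\<bar> \<le> max LV (LT + LI)"
      by (intro exI, rule conjI, rule D(3)) (use b max in linarith)
    show "\<exists>D. ((\<lambda>t. T t + I t) has_real_derivative D) (at t) \<and> \<bar>D\<bar> \<le> max LV (LT + LI)"
      by (intro exI, rule conjI, rule DERIV_add[OF D(1) D(2)]) (use b max in linarith)
  qed
qed

lemma tendsto_of_dissipation_W:
  assumes "\<And>t. t \<ge> tau + 1 \<Longrightarrow> 0 \<le> \<phi> (X t) \<and> \<phi> (X t) \<le> dissipation (T t) (I t) (V t)"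
    and "\<And>e. e > 0 \<Longrightarrow> \<exists>\<eta>>0. \<forall>t\<ge>tau + 1. \<bar>X t - x\<bar> \<ge> e \<longrightarrow> \<phi> (X t) \<ge> \<eta>"
    and "\<And>t. t \<ge> tau + 1 \<Longrightarrow> \<exists>D. (X has_real_derivative D) (at t) \<and> \<bar>D\<bar> \<le> L"
  shows "(X \<longlongrightarrow> x) at_top"
proof (rule tendsto_of_dissipation[where W = W and r = "tau + 1" and \<phi> = \<phi> and L = L])
  fix t assume t: "t \<ge> tau + 1"
  then have "t > 0"
    using tau_nonneg by simp
  then show "W t \<ge> 0"
    using W_terms_nonneg[of t] by (simp add: W_def)
  obtain D where "(W has_real_derivative D) (at t)" "D \<le> - dissipation (T t) (I t) (V t)"
    using DERIV_W[OF \<open>t > 0\<close>] by blast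
  then show "\<exists>D. (W has_real_derivative D) (at t) \<and> D \<le> - \<phi> (X t)"
    using assms(1)[OF t] by (intro exI[of _ D]) auto
qed (use assms in auto)

lemma tendsto_equilibrium: "(T \<longlongrightarrow> T2) at_top" "(I \<longlongrightarrow> I2) at_top" "(V \<longlongrightarrow> V2) at_top"
proof -
  obtain L where L: "\<And>t. t \<ge> tau + 1 \<Longrightarrow> \<exists>D. (T has_real_derivative D) (at t) \<and> \<bar>D\<bar> \<le> L"
    "\<And>t. t \<ge> tau + 1 \<Longrightarrow> \<exists>D. (V has_real_derivative D) (at t) \<and> \<bar>D\<bar> \<le> L"
    "\<And>t. t \<ge> tau + 1 \<Longrightarrow> \<exists>D. ((\<lambda>t. T t + I t) has_real_derivative D) (at t) \<and> \<bar>D\<bar> \<le> L"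
    using bounded_derivatives by blast
  obtain B where B: "B > 0" "\<And>t. t \<ge> 0 \<Longrightarrow> T t \<le> B \<and> I t \<le> B \<and> V t \<le> B"
    using bounded by blast
  have p: "T t > 0" "V t > 0" "V t \<le> B" "T t \<le> B" if "t \<ge> tau + 1" for t
    using TIV_pos[of t] that tau_nonneg B(2)[of t] by auto
  note nonneg = dissipation_terms_nonneg[OF p(1,2)]
  show T_lim: "(T \<longlongrightarrow> T2) at_top"
  proof (rule tendsto_of_dissipation_W[where \<phi> = "\<lambda>x. F2 * volterra (T2 / x)" and L = L])
    show "\<exists>\<eta>>0. \<forall>t\<ge>tau + 1. \<bar>T t - T2\<bar> \<ge> e \<longrightarrow> F2 * volterra (T2 / T t) \<ge> \<eta>" if "e > 0" for e
    proof -
      obtain \<eta> where \<eta>: "\<eta> > 0" "\<And>x. x > 0 \<Longrightarrow> volterra x < \<eta> \<Longrightarrow> \<bar>x - 1\<bar> < e / B"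
        using volterra_small_imp_near_1[OF divide_pos_pos[OF \<open>e > 0\<close> B(1)]] by blast
      have "F2 * volterra (T2 / T t) \<ge> F2 * \<eta>" if t: "t \<ge> tau + 1" "\<bar>T t - T2\<bar> \<ge> e" for t
      proof -
        have "e / B \<le> \<bar>T t - T2\<bar> / T t"
          using t p[OF t(1)] \<open>e > 0\<close> by (intro frac_le) auto
        also have "\<dots> = \<bar>(T2 - T t) / T t\<bar>"
          using p[OF t(1)] by (simp add: abs_minus_commute)
        also have "(T2 - T t) / T t = T2 / T t - 1"
          using p[OF t(1)] by (simp add: diff_divide_distrib)
        finally have "\<not> volterra (T2 / T t) < \<eta>"
          using \<eta>(2)[of "T2 / T t"] p[OF t(1)] eq_pos by fastforce
        then show ?thesis
          using F2_pos by simp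
      qed
      then show ?thesis
        using \<eta>(1) F2_pos by (intro exI[of _ "F2 * \<eta>"]) simp
    qed
  qed (use L nonneg in \<open>auto simp: dissipation_def\<close>)
  show "(V \<longlongrightarrow> V2) at_top"
  proof (rule tendsto_of_dissipation_W[where L = L and
        \<phi> = "\<lambda>v. F2 * (alpha * (v - V2)\<^sup>2 / (V2 * (1 + alpha * V2) * (1 + alpha * v)))"])
    show "\<exists>\<eta>>0. \<forall>t\<ge>tau + 1. \<bar>V t - V2\<bar> \<ge> e \<longrightarrow>
        F2 * (alpha * (V t - V2)\<^sup>2 / (V2 * (1 + alpha * V2) * (1 + alpha * V t))) \<ge> \<eta>" if "e > 0" for e
    proof (intro exI conjI allI impI)
      show "F2 * (alpha * e\<^sup>2 / (V2 * (1 + alpha * V2) * (1 + alpha * B))) > 0"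
        using that pos eq_pos F2_pos B(1) by (auto intro!: mult_pos_pos divide_pos_pos add_pos_pos)
      fix t assume t: "t \<ge> tau + 1" "\<bar>V t - V2\<bar> \<ge> e"
      have "e\<^sup>2 \<le> (V t - V2)\<^sup>2"
        using t(2) that by (simp add: abs_le_square_iff[symmetric])
      then show "F2 * (alpha * (V t - V2)\<^sup>2 / (V2 * (1 + alpha * V2) * (1 + alpha * V t)))
          \<ge> F2 * (alpha * e\<^sup>2 / (V2 * (1 + alpha * V2) * (1 + alpha * B)))"
        using pos eq_pos F2_pos p[OF t(1)]
        by (intro mult_left_mono frac_le) (auto intro!: mult_pos_pos add_pos_pos)
    qed
  qed (use L nonneg in \<open>auto simp: dissipation_def\<close>)
  have "((\<lambda>t. T t + I t) \<longlongrightarrow> T2 + I2) at_top"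
  proof (rule tendsto_of_dissipation_W[where \<phi> = "\<lambda>z. a / Tmax * (z - T2 - I2)\<^sup>2" and L = L])
    show "\<exists>\<eta>>0. \<forall>t\<ge>tau + 1. \<bar>T t + I t - (T2 + I2)\<bar> \<ge> e \<longrightarrow> a / Tmax * (T t + I t - T2 - I2)\<^sup>2 \<ge> \<eta>"
      if "e > 0" for e
    proof (intro exI conjI allI impI)
      show "a / Tmax * e\<^sup>2 > 0"
        using pos that by simp
      fix t assume "\<bar>T t + I t - (T2 + I2)\<bar> \<ge> e"
      then have "e\<^sup>2 \<le> (T t + I t - T2 - I2)\<^sup>2"
        using that by (simp add: abs_le_square_iff[symmetric] diff_diff_eq)
      then show "a / Tmax * (T t + I t - T2 - I2)\<^sup>2 \<ge> a / Tmax * e\<^sup>2"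
        using pos by (intro mult_left_mono) auto
    qed
  qed (use L nonneg in \<open>auto simp: dissipation_def\<close>)
  from tendsto_diff[OF this T_lim] show "(I \<longlongrightarrow> I2) at_top"
    by simp
qed

end

lemma (in infected_equilibrium) stable:
  assumes "\<epsilon> > 0"
  obtains \<delta> where "\<delta> > 0" "\<And>T I V t. positive_solution s d a Tmax b alpha mu p c tau T2 I2 V2 T I V \<Longrightarrow>
      \<forall>\<theta>\<in>{-tau..0}. \<bar>T \<theta> - T2\<bar> < \<delta> \<and> \<bar>I \<theta> - I2\<bar> < \<delta> \<and> \<bar>V \<theta> - V2\<bar> < \<delta> \<Longrightarrow> t \<ge> 0 \<Longrightarrow>
      \<bar>T t - T2\<bar> < \<epsilon> \<and> \<bar>I t - I2\<bar> < \<epsilon> \<and> \<bar>V t - V2\<bar> < \<epsilon>"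
proof -
  define kV where "kV = F2 / (p * I2) * V2"
  have "kV > 0"
    using F2_pos pos eq_pos by (simp add: kV_def)
  obtain \<eta>T where \<eta>T: "\<eta>T > 0" "\<And>x. x > 0 \<Longrightarrow> T2 * volterra (x / T2) < \<eta>T \<Longrightarrow> \<bar>x - T2\<bar> < \<epsilon>"
    using scaled_volterra_small_imp_near[OF eq_pos(1) eq_pos(1) assms] by blast
  obtain \<eta>I where \<eta>I: "\<eta>I > 0" "\<And>x. x > 0 \<Longrightarrow> I2 * volterra (x / I2) < \<eta>I \<Longrightarrow> \<bar>x - I2\<bar> < \<epsilon>"
    using scaled_volterra_small_imp_near[OF eq_pos(2) eq_pos(2) assms] by blast
  obtain \<eta>V where \<eta>V: "\<eta>V > 0" "\<And>x. x > 0 \<Longrightarrow> kV * volterra (x / V2) < \<eta>V \<Longrightarrow> \<bar>x - V2\<bar> < \<epsilon>"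
    using scaled_volterra_small_imp_near[OF eq_pos(3) \<open>kV > 0\<close> assms] by blast
  define \<eta> where "\<eta> = min \<eta>T (min \<eta>I \<eta>V) / 4"
  have \<eta>: "\<eta> > 0" "4 * \<eta> \<le> \<eta>T" "4 * \<eta> \<le> \<eta>I" "4 * \<eta> \<le> \<eta>V"
    using \<eta>T(1) \<eta>I(1) \<eta>V(1) by (auto simp: \<eta>_def)
  define m where "m = \<eta> / (F2 * (tau + 1))"
  have "m > 0" "F2 * m * (tau + 1) = \<eta>"
    using \<eta>(1) F2_pos tau_nonneg by (auto simp: m_def)
  moreover from this have "F2 * m > 0"
    using F2_pos by simp
  ultimately have m: "m > 0" "F2 * (tau * m) < \<eta>"
    by (auto simp: algebra_simps)
  obtain \<delta>T where \<delta>T: "\<delta>T > 0" "\<And>x. \<bar>x - T2\<bar> < \<delta>T \<Longrightarrow> T2 * volterra (x / T2) < \<eta>"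
    using eventually_scaled_volterra_less[OF eq_pos(1) \<eta>(1), of T2]
    unfolding eventually_nhds_metric dist_real_def by blast
  obtain \<delta>I where \<delta>I: "\<delta>I > 0" "\<And>x. \<bar>x - I2\<bar> < \<delta>I \<Longrightarrow> I2 * volterra (x / I2) < \<eta>"
    using eventually_scaled_volterra_less[OF eq_pos(2) \<eta>(1), of I2]
    unfolding eventually_nhds_metric dist_real_def by blast
  obtain \<delta>V where \<delta>V: "\<delta>V > 0" "\<And>x. \<bar>x - V2\<bar> < \<delta>V \<Longrightarrow> kV * volterra (x / V2) < \<eta>"
    using eventually_scaled_volterra_less[OF eq_pos(3) \<eta>(1), of kV]
    unfolding eventually_nhds_metric dist_real_def by blast
  have "\<forall>\<^sub>F y in nhds F2. 1 * volterra (y / F2) < m"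
    by (rule eventually_scaled_volterra_less[OF F2_pos m(1)])
  moreover have "((\<lambda>z. F (fst z) (snd z)) \<longlongrightarrow> F2) (nhds (T2, V2))"
    unfolding incid_def using pos eq_pos
    by (auto intro!: tendsto_eq_intros filterlim_ident simp: add_nonneg_eq_0_iff)
  ultimately have "\<forall>\<^sub>F z in nhds (T2, V2). 1 * volterra (F (fst z) (snd z) / F2) < m"
    by (rule eventually_compose_filterlim)
  then obtain \<delta>F where \<delta>F: "\<delta>F > 0"
      "\<And>x v. dist (x, v) (T2, V2) < \<delta>F \<Longrightarrow> volterra (F x v / F2) < m"
    unfolding eventually_nhds_metric by auto
  define \<delta> where "\<delta> = min (min \<delta>T \<delta>I) (min \<delta>V (\<delta>F / 2))"
  have \<delta>: "\<delta> > 0" "\<delta> \<le> \<delta>T" "\<delta> \<le> \<delta>I" "\<delta> \<le> \<delta>V" "2 * \<delta> \<le> \<delta>F"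
    using \<delta>T(1) \<delta>I(1) \<delta>V(1) \<delta>F(1) by (auto simp: \<delta>_def)
  show ?thesis
  proof (rule that[OF \<delta>(1)])
    fix T I V :: "real \<Rightarrow> real" and t :: real
    assume "positive_solution s d a Tmax b alpha mu p c tau T2 I2 V2 T I V"
      and near: "\<forall>\<theta>\<in>{-tau..0}. \<bar>T \<theta> - T2\<bar> < \<delta> \<and> \<bar>I \<theta> - I2\<bar> < \<delta> \<and> \<bar>V \<theta> - V2\<bar> < \<delta>"
      and "t \<ge> 0"
    then interpret positive_solution s d a Tmax b alpha mu p c tau T2 I2 V2 T I V
      by simp
    have "volterra (F (T \<theta>) (V \<theta>) / F2) \<le> m" if "\<theta> \<in> {-tau..0}" for \<theta>
    proof -
      have "dist (T \<theta>, V \<theta>) (T2, V2) \<le> \<bar>T \<theta> - T2\<bar> + \<bar>V \<theta> - V2\<bar>"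
        unfolding dist_Pair_Pair dist_real_def
        using sqrt_sum_squares_le_sum_abs[of "T \<theta> - T2" "V \<theta> - V2"] by simp
      also have "\<dots> < \<delta>F"
        using near that \<delta>(5) by fastforce
      finally show ?thesis
        using \<delta>F(2) by (simp add: less_imp_le)
    qed
    then have G0: "F2 * (G 0 - G (0 - tau)) \<le> F2 * (tau * m)"
      using F2_pos by (intro mult_left_mono G_diff_0_le) auto
    have "\<bar>T 0 - T2\<bar> < \<delta> \<and> \<bar>I 0 - I2\<bar> < \<delta> \<and> \<bar>V 0 - V2\<bar> < \<delta>"
      using near tau_nonneg by simp
    then have "\<bar>T 0 - T2\<bar> < \<delta>T" "\<bar>I 0 - I2\<bar> < \<delta>I" "\<bar>V 0 - V2\<bar> < \<delta>V"
      using \<delta> by linarith+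
    then have "W 0 < 4 * \<eta>"
      using G0 \<delta>T(2)[of "T 0"] \<delta>I(2)[of "I 0"] \<delta>V(2)[of "V 0"] m(2)
      unfolding W_def kV_def by (simp add: mult.assoc)
    then show "\<bar>T t - T2\<bar> < \<epsilon> \<and> \<bar>I t - I2\<bar> < \<epsilon> \<and> \<bar>V t - V2\<bar> < \<epsilon>"
      using W_terms_le[OF \<open>t \<ge> 0\<close>, folded kV_def] TIV_pos[of t] \<open>t \<ge> 0\<close> tau_nonneg \<eta>
      by (intro conjI \<eta>T(2) \<eta>I(2) \<eta>V(2)) auto
  qed
qed

theorem theorem4:
  fixes s d a Tmax b alpha mu p c tau T2 I2 V2 :: real
  assumes "s > 0" "d > 0" "a > 0" "Tmax > 0" "b > 0" "alpha > 0" "mu > 0" "p > 0" "c > 0"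
    and "tau \<ge> 0"
    and "R0 s d a Tmax b mu p c > 1"
    and "T2 > 0" "I2 > 0" "V2 > 0"
    and "is_equilibrium s d a Tmax b alpha mu p c T2 I2 V2"
    and "a \<le> d + a / Tmax * (T2 + I2)"
  shows "globally_asymptotically_stable s d a Tmax b alpha mu p c tau T2 I2 V2"
proof -
  interpret infected_equilibrium s d a Tmax b alpha mu p c tau T2 I2 V2
    using assms by unfold_locales
  have sol: "positive_solution s d a Tmax b alpha mu p c tau T2 I2 V2 T I V"
    if "is_solution s d a Tmax b alpha mu p c tau T I V" "positive_initial tau T I V" for T I V
    using that by unfold_locales
  show ?thesis
    unfolding globally_asymptotically_stable_def
  proof (intro conjI allI impI)
    fix \<epsilon> :: real assume "\<epsilon> > 0"
    then obtain \<delta> where \<delta>: "\<delta> > 0"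
      "\<And>T I V t. positive_solution s d a Tmax b alpha mu p c tau T2 I2 V2 T I V \<Longrightarrow>
        \<forall>\<theta>\<in>{-tau..0}. \<bar>T \<theta> - T2\<bar> < \<delta> \<and> \<bar>I \<theta> - I2\<bar> < \<delta> \<and> \<bar>V \<theta> - V2\<bar> < \<delta> \<Longrightarrow> t \<ge> 0 \<Longrightarrow>
        \<bar>T t - T2\<bar> < \<epsilon> \<and> \<bar>I t - I2\<bar> < \<epsilon> \<and> \<bar>V t - V2\<bar> < \<epsilon>"
      using stable by blast
    show "\<exists>\<delta>>0. \<forall>T I V.
        is_solution s d a Tmax b alpha mu p c tau T I V \<and> positive_initial tau T I V \<and>
        (\<forall>\<theta>\<in>{-tau..0}. \<bar>T \<theta> - T2\<bar> < \<delta> \<and> \<bar>I \<theta> - I2\<bar> < \<delta> \<and> \<bar>V \<theta> - V2\<bar> < \<delta>)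
        \<longrightarrow> (\<forall>t\<ge>0. \<bar>T t - T2\<bar> < \<epsilon> \<and> \<bar>I t - I2\<bar> < \<epsilon> \<and> \<bar>V t - V2\<bar> < \<epsilon>)"
      using \<delta>(1) \<delta>(2)[OF sol] by (intro exI[of _ \<delta>]) blast
  next
    fix T I V
    assume "is_solution s d a Tmax b alpha mu p c tau T I V \<and> positive_initial tau T I V"
    then interpret positive_solution s d a Tmax b alpha mu p c tau T2 I2 V2 T I V
      using sol by simp
    show "(T \<longlongrightarrow> T2) at_top" "(I \<longlongrightarrow> I2) at_top" "(V \<longlongrightarrow> V2) at_top"
      by (fact tendsto_equilibrium)+
  qed
qed

end
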